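(* Let $X$ be a real normed linear space and let $x\in X$. Then the following are equivalent: (a) $x$ is a left-symmetric point in $X$. (b) For every $y\in X$, $\rho_+(x,y)\geq 0$ implies $\rho_+(y,x)\geq 0$. (c) For every $y\in X$, $\rho_-(x,y)\leq 0$ implies $\rho_-(y,x)\leq 0$.
   Context: For $x,y$ in a real normed linear space $X$, $\rho_{\pm}(x,y)=\lim_{\lambda\to 0^{\pm}}\frac{\|x+\lambda y\|-\|x\|}{\lambda}$. Birkhoff-James orthogonality: $x\perp_B y$ means $\|x+\lambda y\|\geq\|x\|$ for all $\lambda\in\mathbb{R}$. An element $x\in X$ is left-symmetric if for every $y\in X$, $x\perp_B y$ implies $y\perp_B x$. *)

theory Defs
  imports "HOL-Analysis.Analysis"
begin

(* Norm derivatives.  The difference quotient is monotone in l (convexity of the norm) and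
   bounded by norm y in absolute value, so both one-sided limits exist for all x and y,
   including x = 0; hence Lim never denotes an unspecified value here. *)

definition rho_plus :: "'a::real_normed_vector \<Rightarrow> 'a \<Rightarrow> real" where
  "rho_plus x y = Lim (at_right 0) (\<lambda>l::real. (norm (x + l *\<^sub>R y) - norm x) / l)"

definition rho_minus :: "'a::real_normed_vector \<Rightarrow> 'a \<Rightarrow> real" where
  "rho_minus x y = Lim (at_left 0) (\<lambda>l::real. (norm (x + l *\<^sub>R y) - norm x) / l)"

definition birkhoff_orthogonal :: "'a::real_normed_vector \<Rightarrow> 'a \<Rightarrow> bool" where
  "birkhoff_orthogonal x y \<longleftrightarrow> (\<forall>l::real. norm (x + l *\<^sub>R y) \<ge> norm x)"

definition left_symmetric :: "'a::real_normed_vector \<Rightarrow> bool" where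
  "left_symmetric x \<longleftrightarrow> (\<forall>y. birkhoff_orthogonal x y \<longrightarrow> birkhoff_orthogonal y x)"

end

theory Submission
  imports Defs
begin

text \<open>
  Since the difference quotient of the norm is monotone, \<open>rho_plus x y\<close> is the infimum of the
  quotients with positive parameter. Hence \<open>rho_plus x y \<ge> 0\<close> says that the norm does not drop
  along the ray from \<open>x\<close> in direction \<open>y\<close>, which is one half of Birkhoff-James orthogonality;
  \<open>rho_minus x y \<le> 0\<close> is the same condition for \<open>- y\<close>. Thus (b) and (c) are exchanged by
  \<open>y \<mapsto> - y\<close>, and (b) implies (a) by applying (b) to both \<open>y\<close> and \<open>- y\<close>.

  For (a) implies (b) with \<open>x \<noteq> 0\<close>, the value \<open>r = rho_plus x y\<close> is a subgradient:
  \<open>c x + l y \<mapsto> c \<parallel>x\<parallel> + l r\<close> is dominated by the norm on the plane of \<open>x\<close> and \<open>y\<close>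
  (lemma \<open>norm_ge_rho_plus_functional\<close>). The vector \<open>z = y - (r / \<parallel>x\<parallel>) x\<close> lies in the kernel
  of this functional, so \<open>x\<close> is orthogonal to \<open>z\<close>, and left symmetry makes \<open>z\<close> orthogonal to \<open>x\<close>.
  So the convex function \<open>t \<mapsto> \<parallel>z + t x\<parallel>\<close> has its minimum at \<open>0\<close> and is nondecreasing from there on. If
  \<open>r \<ge> 0\<close>, then \<open>y\<close> is the point with parameter \<open>r / \<parallel>x\<parallel> \<ge> 0\<close> on this line, and the norm
  does not drop when moving from \<open>y\<close> in direction \<open>x\<close>.
\<close>

text \<open>Convexity of the norm along a line, without denominators: \<open>u\<close> divides the segment from
  \<open>u - b v\<close> to \<open>u + a v\<close> in the ratio \<open>b : a\<close>. All convexity arguments below are instances.\<close>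

lemma norm_between:
  fixes u v :: "'a::real_normed_vector"
  assumes "0 \<le> a" "0 \<le> b"
  shows "(a + b) * norm u \<le> a * norm (u - b *\<^sub>R v) + b * norm (u + a *\<^sub>R v)"
proof -
  have "(a + b) *\<^sub>R u = a *\<^sub>R (u - b *\<^sub>R v) + b *\<^sub>R (u + a *\<^sub>R v)"
    by (simp add: algebra_simps)
  then have "norm ((a + b) *\<^sub>R u) \<le> norm (a *\<^sub>R (u - b *\<^sub>R v)) + norm (b *\<^sub>R (u + a *\<^sub>R v))"
    by (metis norm_triangle_ineq)
  then show ?thesis
    using assms by simp
qed

lemma norm_quotient_mono:
  fixes x y :: "'a::real_normed_vector"
  assumes "0 < a" "a \<le> b"
  shows "(norm (x + a *\<^sub>R y) - norm x) / a \<le> (norm (x + b *\<^sub>R y) - norm x) / b"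
proof -
  have "b * norm (x + a *\<^sub>R y) \<le> (b - a) * norm x + a * norm (x + b *\<^sub>R y)"
    using norm_between[of "b - a" a "x + a *\<^sub>R y" y] assms
    by (simp add: algebra_simps)
  then show ?thesis
    using assms by (simp add: field_simps)
qed

lemma norm_quotient_ge:
  fixes x y :: "'a::real_normed_vector"
  assumes "0 < l"
  shows "- norm y \<le> (norm (x + l *\<^sub>R y) - norm x) / l"
proof -
  have "norm x \<le> norm (x + l *\<^sub>R y) + norm (l *\<^sub>R y)"
    by (metis add_diff_cancel_right' norm_triangle_ineq4)
  then show ?thesis
    using assms by (simp add: field_simps)
qed

lemma rho_plus_limit_INF:
  fixes x y :: "'a::real_normed_vector"
  shows "((\<lambda>l. (norm (x + l *\<^sub>R y) - norm x) / l) \<longlongrightarrow>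
           (INF l\<in>{0<..}. (norm (x + l *\<^sub>R y) - norm x) / l)) (at_right 0)"
  using Lim_right_bound[of UNIV 0 "\<lambda>l. (norm (x + l *\<^sub>R y) - norm x) / l" "- norm y"]
  by (simp add: norm_quotient_mono norm_quotient_ge)

lemma rho_plus_eq_INF:
  "rho_plus x y = (INF l\<in>{0<..}. (norm (x + l *\<^sub>R y) - norm x) / l)"
  unfolding rho_plus_def by (rule tendsto_Lim[OF _ rho_plus_limit_INF]) simp

lemma rho_plus_le_quotient:
  assumes "0 < l"
  shows "rho_plus x y \<le> (norm (x + l *\<^sub>R y) - norm x) / l"
  unfolding rho_plus_eq_INF
  by (rule cINF_lower) (use assms in \<open>auto intro!: bdd_belowI2[of _ "- norm y"] norm_quotient_ge\<close>)

lemma rho_plus_greatest: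
  assumes "\<And>l. 0 < l \<Longrightarrow> m \<le> (norm (x + l *\<^sub>R y) - norm x) / l"
  shows "m \<le> rho_plus x y"
  unfolding rho_plus_eq_INF by (rule cINF_greatest) (use assms in \<open>auto intro: exI[of _ 1]\<close>)

text \<open>The substitution \<open>l \<mapsto> - l\<close> turns the left-hand limit into a right-hand one.\<close>

lemma rho_minus_eq: "rho_minus x y = - rho_plus x (- y)"
proof -
  have "((\<lambda>l. (norm (x + l *\<^sub>R y) - norm x) / l) \<longlongrightarrow> - rho_plus x (- y)) (at_left 0)"
    using tendsto_minus[OF rho_plus_limit_INF[of x "- y"]]
    by (simp add: filterlim_at_left_to_right rho_plus_eq_INF)
  then show ?thesis
    unfolding rho_minus_def by (intro tendsto_Lim) simp_all
qed

lemma rho_plus_nonneg_iff: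
  "0 \<le> rho_plus x y \<longleftrightarrow> (\<forall>l\<ge>0. norm x \<le> norm (x + l *\<^sub>R y))"
proof
  assume r: "0 \<le> rho_plus x y"
  show "\<forall>l\<ge>0. norm x \<le> norm (x + l *\<^sub>R y)"
  proof (intro allI impI)
    fix l :: real
    assume "0 \<le> l"
    then show "norm x \<le> norm (x + l *\<^sub>R y)"
      using order_trans[OF r rho_plus_le_quotient[of l x y]]
      by (cases "l = 0") (auto simp: zero_le_divide_iff)
  qed
qed (auto intro!: rho_plus_greatest)

lemma rho_plus_minus_minus: "0 \<le> rho_plus (- x) (- y) \<longleftrightarrow> 0 \<le> rho_plus x y"
proof -
  have "norm (- x + l *\<^sub>R (- y)) = norm (x + l *\<^sub>R y)" for l
    by (metis minus_add_distrib norm_minus_cancel scaleR_minus_right)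
  then show ?thesis
    by (simp add: rho_plus_nonneg_iff)
qed

lemma birkhoff_orthogonal_iff_rho_plus:
  "birkhoff_orthogonal x y \<longleftrightarrow> 0 \<le> rho_plus x y \<and> 0 \<le> rho_plus x (- y)"
proof
  assume h: "0 \<le> rho_plus x y \<and> 0 \<le> rho_plus x (- y)"
  have "norm x \<le> norm (x + l *\<^sub>R y)" for l
  proof (cases "0 \<le> l")
    case False
    then have "norm x \<le> norm (x + (- l) *\<^sub>R (- y))"
      using h unfolding rho_plus_nonneg_iff by (metis le_cases neg_0_le_iff_le)
    then show ?thesis by simp
  qed (use h in \<open>auto simp: rho_plus_nonneg_iff\<close>)
  then show "birkhoff_orthogonal x y"
    by (simp add: birkhoff_orthogonal_def)
next
  assume h: "birkhoff_orthogonal x y"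
  then have "norm x \<le> norm (x + l *\<^sub>R (- y))" for l
    using birkhoff_orthogonal_def[of x y] by (metis scaleR_minus_left scaleR_minus_right)
  with h show "0 \<le> rho_plus x y \<and> 0 \<le> rho_plus x (- y)"
    by (simp add: birkhoff_orthogonal_def rho_plus_nonneg_iff)
qed

lemma abs_rho_plus_le: "\<bar>rho_plus x y\<bar> \<le> norm y"
proof -
  have "rho_plus x y \<le> norm (x + y) - norm x"
    using rho_plus_le_quotient[of 1 x y] by simp
  moreover have "norm (x + y) - norm x \<le> norm y"
    using norm_triangle_ineq[of x y] by simp
  moreover have "- norm y \<le> rho_plus x y"
    by (intro rho_plus_greatest norm_quotient_ge)
  ultimately show ?thesis by simp
qed

text \<open>For positive \<open>l\<close> this is the infimum property. For negative \<open>l\<close> it holds because, by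
  convexity, every quotient on the left of \<open>0\<close> is a lower bound of those on the right.\<close>

lemma rho_plus_subgradient:
  "norm x + l * rho_plus x y \<le> norm (x + l *\<^sub>R y)"
proof (cases l "0 :: real" rule: linorder_cases)
  case greater
  then show ?thesis
    using rho_plus_le_quotient[of l x y] by (simp add: field_simps)
next
  case less
  have "(norm (x + l *\<^sub>R y) - norm x) / l \<le> (norm (x + a *\<^sub>R y) - norm x) / a" if "0 < a" for a
    using norm_between[of a "- l" x y] less that by (simp add: field_simps)
  then have "(norm (x + l *\<^sub>R y) - norm x) / l \<le> rho_plus x y"
    by (rule rho_plus_greatest)
  then show ?thesis
    using less by (simp add: field_simps)
qed simp

text \<open>The norm dominates the linear functional on the plane of \<open>x\<close> and \<open>y\<close> which takes the values
  \<open>\<parallel>x\<parallel>\<close> at \<open>x\<close> and \<open>rho_plus x y\<close> at \<open>y\<close>. For \<open>c > 0\<close> this is the subgradient inequality,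
  rescaled; for \<open>c \<le> 0\<close> the triangle inequality and \<open>\<bar>rho_plus x y\<bar> \<le> \<parallel>y\<parallel>\<close> suffice.\<close>

lemma norm_ge_rho_plus_functional:
  "c * norm x + l * rho_plus x y \<le> norm (c *\<^sub>R x + l *\<^sub>R y)"
proof (cases "0 < c")
  case True
  have "c * norm x + l * rho_plus x y = c * (norm x + (l / c) * rho_plus x y)"
    using True by (simp add: field_simps)
  also have "\<dots> \<le> c * norm (x + (l / c) *\<^sub>R y)"
    using True rho_plus_subgradient[of x "l / c" y] by (intro mult_left_mono) auto
  also have "\<dots> = norm (c *\<^sub>R (x + (l / c) *\<^sub>R y))"
    using True by simp
  also have "c *\<^sub>R (x + (l / c) *\<^sub>R y) = c *\<^sub>R x + l *\<^sub>R y"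
    using True by (simp add: scaleR_add_right)
  finally show ?thesis .
next
  case False
  have "l * rho_plus x y \<le> \<bar>l\<bar> * \<bar>rho_plus x y\<bar>"
    by (metis abs_ge_self abs_mult)
  also have "\<dots> \<le> \<bar>l\<bar> * norm y"
    by (intro mult_left_mono abs_rho_plus_le) simp
  also have "\<dots> = norm ((c *\<^sub>R x + l *\<^sub>R y) - c *\<^sub>R x)"
    by simp
  also have "\<dots> \<le> norm (c *\<^sub>R x + l *\<^sub>R y) + norm (c *\<^sub>R x)"
    by (rule norm_triangle_ineq4)
  finally show ?thesis
    using False by simp
qed

text \<open>Removing from \<open>y\<close> its component along \<open>x\<close>, as measured by the functional above, leaves a
  vector in the kernel of that functional.\<close>

lemma birkhoff_orthogonal_rho_plus_projection:
  fixes x y :: "'a::real_normed_vector"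
  assumes "x \<noteq> 0"
  shows "birkhoff_orthogonal x (y - (rho_plus x y / norm x) *\<^sub>R x)"
  unfolding birkhoff_orthogonal_def
proof
  fix l :: real
  define s where "s = rho_plus x y / norm x"
  have "norm x = (1 - l * s) * norm x + l * rho_plus x y"
    using assms by (simp add: s_def field_simps)
  also have "\<dots> \<le> norm ((1 - l * s) *\<^sub>R x + l *\<^sub>R y)"
    by (rule norm_ge_rho_plus_functional)
  also have "(1 - l * s) *\<^sub>R x + l *\<^sub>R y = x + l *\<^sub>R (y - s *\<^sub>R x)"
    by (simp add: algebra_simps)
  finally show "norm x \<le> norm (x + l *\<^sub>R (y - (rho_plus x y / norm x) *\<^sub>R x))"
    by (simp add: s_def)
qed

text \<open>A convex function with its minimum at \<open>0\<close> is nondecreasing on the positive half line.\<close>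

lemma birkhoff_orthogonal_imp_rho_plus_nonneg:
  fixes z x :: "'a::real_normed_vector"
  assumes "birkhoff_orthogonal z x" "0 \<le> s"
  shows "0 \<le> rho_plus (z + s *\<^sub>R x) x"
  unfolding rho_plus_nonneg_iff
proof (intro allI impI)
  fix l :: real
  assume l: "0 \<le> l"
  let ?N = "norm (z + s *\<^sub>R x + l *\<^sub>R x)"
  have "norm z \<le> norm (z + (s + l) *\<^sub>R x)"
    using assms(1) by (simp add: birkhoff_orthogonal_def)
  then have "l * norm z \<le> l * ?N"
    using l by (intro mult_left_mono) (simp_all add: scaleR_add_left add.assoc)
  then have "(l + s) * norm (z + s *\<^sub>R x) \<le> (l + s) * ?N"
    using norm_between[of l s "z + s *\<^sub>R x" x] l assms(2) by (simp add: algebra_simps)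
  then show "norm (z + s *\<^sub>R x) \<le> ?N"
    using l assms(2) by (cases "l = 0") auto
qed

lemma left_symmetric_iff_rho_plus:
  fixes x :: "'a::real_normed_vector"
  shows "left_symmetric x \<longleftrightarrow> (\<forall>y. 0 \<le> rho_plus x y \<longrightarrow> 0 \<le> rho_plus y x)"
proof
  assume ls: "left_symmetric x"
  show "\<forall>y. 0 \<le> rho_plus x y \<longrightarrow> 0 \<le> rho_plus y x"
  proof (intro allI impI)
    fix y
    assume r: "0 \<le> rho_plus x y"
    show "0 \<le> rho_plus y x"
    proof (cases "x = 0")
      case True
      then show ?thesis by (simp add: rho_plus_nonneg_iff)
    next
      case False
      define s where "s = rho_plus x y / norm x"
      have "birkhoff_orthogonal (y - s *\<^sub>R x) x"
        using ls birkhoff_orthogonal_rho_plus_projection[OF False, of y]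
        by (simp add: left_symmetric_def s_def)
      then have "0 \<le> rho_plus (y - s *\<^sub>R x + s *\<^sub>R x) x"
        by (rule birkhoff_orthogonal_imp_rho_plus_nonneg) (simp add: s_def r)
      then show ?thesis by simp
    qed
  qed
next
  assume "\<forall>y. 0 \<le> rho_plus x y \<longrightarrow> 0 \<le> rho_plus y x"
  then show "left_symmetric x"
    unfolding left_symmetric_def birkhoff_orthogonal_iff_rho_plus
    by (metis minus_minus rho_plus_minus_minus)
qed

theorem corollary2p2p1:
  fixes x :: "'a::real_normed_vector"
  shows "(left_symmetric x \<longleftrightarrow> (\<forall>y. rho_plus x y \<ge> 0 \<longrightarrow> rho_plus y x \<ge> 0)) \<and>
         (left_symmetric x \<longleftrightarrow> (\<forall>y. rho_minus x y \<le> 0 \<longrightarrow> rho_minus y x \<le> 0))"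
proof -
  have x_left: "rho_minus x (- y) \<le> 0 \<longleftrightarrow> 0 \<le> rho_plus x y" for y
    by (simp add: rho_minus_eq)
  have x_right: "rho_minus (- y) x \<le> 0 \<longleftrightarrow> 0 \<le> rho_plus y x" for y
    by (simp add: rho_minus_eq rho_plus_minus_minus)
  have "(\<forall>y. rho_minus x y \<le> 0 \<longrightarrow> rho_minus y x \<le> 0) \<longleftrightarrow>
        (\<forall>y. 0 \<le> rho_plus x y \<longrightarrow> 0 \<le> rho_plus y x)"
    by (metis x_left x_right minus_minus)
  then show ?thesis
    by (simp add: left_symmetric_iff_rho_plus)
qed

end
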